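(* For all terms $t,t',t''$ and state formulas $\varphi,\psi$ such that each left-hand side below is a formula in normal form ($\mathcal{L}^0$), the following hold: 1. $\langle\langle t',t''\rangle\rangle\mathsf{G}\varphi\equiv\varphi\wedge\langle\langle t',t''\rangle\rangle\mathsf{X}\langle\langle t',t''\rangle\rangle\mathsf{G}\varphi$; 2. $\langle\langle t',t''\rangle\rangle\psi\,\mathsf{U}\,\varphi\equiv\varphi\vee(\psi\wedge\langle\langle t',t''\rangle\rangle\mathsf{X}\langle\langle t',t''\rangle\rangle\psi\,\mathsf{U}\,\varphi)$; 3. $\exists y_1\langle\langle y_1,t\rangle\rangle\mathsf{G}\varphi\equiv_{fin}\varphi\wedge\exists y_1\langle\langle y_1,t\rangle\rangle\mathsf{X}\exists y_1\langle\langle y_1,t\rangle\rangle\mathsf{G}\varphi$; 4. $\forall y_2\langle\langle t,y_2\rangle\rangle\mathsf{G}\varphi\equiv_{fin}\varphi\wedge\forall y_2\langle\langle t,y_2\rangle\rangle\mathsf{X}\forall y_2\langle\langle t,y_2\rangle\rangle\mathsf{G}\varphi$; 5. $\exists y_1\langle\langle y_1,t\rangle\rangle\psi\,\mathsf{U}\,\varphi\equiv_{fin}\varphi\vee(\psi\wedge\exists y_1\langle\langle y_1,t\rangle\rangle\mathsf{X}\exists y_1\langle\langle y_1,t\rangle\rangle\psi\,\mathsf{U}\,\varphi)$; 6. $\forall y_2\langle\langle t,y_2\rangle\rangle\psi\,\mathsf{U}\,\varphi\equiv_{fin}\varphi\vee(\psi\wedge\forall y_2\langle\langle t,y_2\rangle\rangle\mathsf{X}\forall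 y_2\langle\langle t,y_2\rangle\rangle\psi\,\mathsf{U}\,\varphi)$; 7. $\forall y_2\exists y_1\langle\langle y_1,y_2\rangle\rangle\mathsf{G}\varphi\equiv_{fin}\varphi\wedge\forall y_2\exists y_1\langle\langle y_1,y_2\rangle\rangle\mathsf{X}\forall y_2\exists y_1\langle\langle y_1,y_2\rangle\rangle\mathsf{G}\varphi$; 8. $\exists y_1\forall y_2\langle\langle y_1,y_2\rangle\rangle\mathsf{G}\varphi\equiv_{fin}\varphi\wedge\exists y_1\forall y_2\langle\langle y_1,y_2\rangle\rangle\mathsf{X}\exists y_1\forall y_2\langle\langle y_1,y_2\rangle\rangle\mathsf{G}\varphi$; 9. $\forall y_2\exists y_1\langle\langle y_1,y_2\rangle\rangle\psi\,\mathsf{U}\,\varphi\equiv_{fin}\varphi\vee(\psi\wedge\forall y_2\exists y_1\langle\langle y_1,y_2\rangle\rangle\mathsf{X}\forall y_2\exists y_1\langle\langle y_1,y_2\rangle\rangle\psi\,\mathsf{U}\,\varphi)$; 10. $\exists y_1\forall y_2\langle\langle y_1,y_2\rangle\rangle\psi\,\mathsf{U}\,\varphi\equiv_{fin}\varphi\vee(\psi\wedge\exists y_1\forall y_2\langle\langle y_1,y_2\rangle\rangle\mathsf{X}\exists y_1\forall y_2\langle\langle y_1,y_2\rangle\rangle\psi\,\mathsf{U}\,\varphi)$.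
   Context: HDMAS models: $\mathcal{M}=\langle\mathit{Ag},\mathit{Act}^+,S,d,\delta,\mathit{AP},\lambda\rangle$ with states $S$, actions $\mathit{Act}^+=\{act_1,\dots,act_n,\varepsilon\}$ ($\varepsilon$ idle), available actions $d(s)\ni\varepsilon$, and transitions determined by quantifier-free Presburger guards $\delta(s,s')$ over the numbers $x_i$ of agents performing $act_i$, such that every vector of counts over the available actions satisfies exactly one outgoing guard; labelling $\lambda:S\to\mathcal{P}(\mathit{AP})$. An abstract joint strategy for $C$ agents assigns to each state a distribution of $C$ agents over its available actions; the outcome plays against $N$ uncontrollable agents are the state sequences from $s$ in which each successor is the state whose guard is satisfied by the sum of the strategy's distribution and some distribution of $N$ agents over the available actions. Semantics: $\mathcal{M},s,\theta\models\langle\langle t_1,t_2\rangle\rangle\chi$ iff some abstract joint strategy for $\theta(t_1)$ agents makes every outcome play from $s$ against $\theta(t_2)$ agents satisfy $\chi$ ($\mathsf{X}$: next state; $\mathsf{G}$: all states; $\psi\mathsf{U}\varphi$: $\varphi$ at some position, $\psi$ at all earlier ones); $p$ true iff $p\in\lambda(s)$; Booleans standard; $\forall y,\exists y$ range over $\mathbb{N}$. Syntax: terms $T=\{y_1,y_2\}\cup\{z_1,z_2,\dots\}\cup\mathbb{N}$, assignments $\theta:T\to\mathbb{N}$ fixing numerals; state formulas $\top,p,\neg,\wedge,\vee,\langle\langle t_1,t_2\rangle\rangle\chi$ ($t_1\in T\setminus\{y_2\}$, $t_2\in T\setminus\{y_1\}$, $\chi$ one of $\mathsf{X}\varphi,\mathsf{G}\varphi,\psi\mathsf{U}\varphi$),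 and $\forall y\varphi$, $\exists y\varphi$ for $y\in\{y_1,y_2\}$ with all free occurrences of $y$ in $\varphi$ in the scope of an even number of negations. Normal form $\mathcal{L}^0$: (NF1) no $\forall y_1$, no $\exists y_2$; (NF2) every subformula $\langle\langle t_1,t_2\rangle\rangle\chi$ with exactly one of $t_1=y_1$, $t_2=y_2$, that occurrence bound, is immediately preceded by $\exists y_1$ resp. $\forall y_2$; (NF3) every $\langle\langle y_1,y_2\rangle\rangle\chi$ with both occurrences bound is immediately preceded by $\forall y_2\exists y_1$ or $\exists y_1\forall y_2$. $\equiv$: same truth value at every model, state and assignment; $\equiv_{fin}$: same, restricted to HDMAS with finite state space.
   Formalization: (NF2) is also imposed on ⟨⟨y1,y2⟩⟩χ with exactly one of the two occurrences bound (the other free); otherwise item 3 fails, e.g. for ∃y1⟨⟨y1,0⟩⟩G⟨⟨y1,y2⟩⟩X p with y2 free, where y1 becomes free in the first conjunct on the right. *)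

theory Defs
  imports Main
begin

section \<open>Presburger guards\<close>

datatype action = Idle | Act nat

datatype pterm = PConst nat | PCount nat | PAdd pterm pterm

datatype guard =
    GTrue
  | GEq pterm pterm
  | GLess pterm pterm
  | GNot guard
  | GAnd guard guard
  | GOr guard guard

primrec pterm_vars :: "pterm \<Rightarrow> nat set" where
  "pterm_vars (PConst k) = {}"
| "pterm_vars (PCount i) = {i}"
| "pterm_vars (PAdd a b) = pterm_vars a \<union> pterm_vars b"

primrec guard_vars :: "guard \<Rightarrow> nat set" where
  "guard_vars GTrue = {}"
| "guard_vars (GEq a b) = pterm_vars a \<union> pterm_vars b"
| "guard_vars (GLess a b) = pterm_vars a \<union> pterm_vars b"
| "guard_vars (GNot g) = guard_vars g"
| "guard_vars (GAnd g h) = guard_vars g \<union> guard_vars h"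
| "guard_vars (GOr g h) = guard_vars g \<union> guard_vars h"

text \<open>The variable \<open>PCount i\<close> denotes the number of agents performing \<open>Act i\<close>;
  the number of idling agents is not visible to guards.\<close>

primrec pterm_val :: "(action \<Rightarrow> nat) \<Rightarrow> pterm \<Rightarrow> nat" where
  "pterm_val \<nu> (PConst k) = k"
| "pterm_val \<nu> (PCount i) = \<nu> (Act i)"
| "pterm_val \<nu> (PAdd a b) = pterm_val \<nu> a + pterm_val \<nu> b"

primrec guard_sat :: "(action \<Rightarrow> nat) \<Rightarrow> guard \<Rightarrow> bool" where
  "guard_sat \<nu> GTrue = True"
| "guard_sat \<nu> (GEq a b) = (pterm_val \<nu> a = pterm_val \<nu> b)"
| "guard_sat \<nu> (GLess a b) = (pterm_val \<nu> a < pterm_val \<nu> b)"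
| "guard_sat \<nu> (GNot g) = (\<not> guard_sat \<nu> g)"
| "guard_sat \<nu> (GAnd g h) = (guard_sat \<nu> g \<and> guard_sat \<nu> h)"
| "guard_sat \<nu> (GOr g h) = (guard_sat \<nu> g \<or> guard_sat \<nu> h)"


section \<open>Homogeneous dynamic multi-agent systems\<close>

text \<open>The actions are \<open>Act 1, \<dots>, Act (num_acts M)\<close> and \<open>Idle\<close>. The field \<open>agents\<close> is
  unconstrained: the abstract semantics refers to numbers of agents only.\<close>

record ('ag, 's, 'p) hdmas =
  agents :: "'ag set"
  num_acts :: nat
  states :: "'s set"
  avail :: "'s \<Rightarrow> action set"
  trans_guard :: "'s \<Rightarrow> 's \<Rightarrow> guard"
  props :: "'p set"
  labels :: "'s \<Rightarrow> 'p set"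

definition all_actions :: "('ag, 's, 'p) hdmas \<Rightarrow> action set" where
  "all_actions M = insert Idle (Act ` {1..num_acts M})"

definition counts :: "('ag, 's, 'p) hdmas \<Rightarrow> 's \<Rightarrow> (action \<Rightarrow> nat) set" where
  "counts M s = {\<nu>. \<forall>a. a \<notin> avail M s \<longrightarrow> \<nu> a = 0}"

definition distributions :: "('ag, 's, 'p) hdmas \<Rightarrow> 's \<Rightarrow> nat \<Rightarrow> (action \<Rightarrow> nat) set" where
  "distributions M s k = {\<nu> \<in> counts M s. (\<Sum>a\<in>avail M s. \<nu> a) = k}"

definition is_hdmas :: "('ag, 's, 'p) hdmas \<Rightarrow> bool" where
  "is_hdmas M \<longleftrightarrow>
    (\<forall>s\<in>states M. avail M s \<subseteq> all_actions M \<and> Idle \<in> avail M s) \<and>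
    (\<forall>s\<in>states M. \<forall>s'\<in>states M. guard_vars (trans_guard M s s') \<subseteq> {1..num_acts M}) \<and>
    (\<forall>s\<in>states M. \<forall>\<nu>\<in>counts M s. \<exists>!s'. s' \<in> states M \<and> guard_sat \<nu> (trans_guard M s s')) \<and>
    (\<forall>s\<in>states M. labels M s \<subseteq> props M)"

definition joint_strategy :: "('ag, 's, 'p) hdmas \<Rightarrow> nat \<Rightarrow> ('s \<Rightarrow> action \<Rightarrow> nat) \<Rightarrow> bool" where
  "joint_strategy M C \<sigma> \<longleftrightarrow> (\<forall>s\<in>states M. \<sigma> s \<in> distributions M s C)"

definition outcome_plays ::
  "('ag, 's, 'p) hdmas \<Rightarrow> 's \<Rightarrow> ('s \<Rightarrow> action \<Rightarrow> nat) \<Rightarrow> nat \<Rightarrow> (nat \<Rightarrow> 's) set" where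
  "outcome_plays M s \<sigma> N =
    {\<pi>. \<pi> 0 = s \<and> (\<forall>i. \<pi> i \<in> states M) \<and>
        (\<forall>i. \<exists>\<nu>\<in>distributions M (\<pi> i) N.
           guard_sat (\<lambda>a. \<sigma> (\<pi> i) a + \<nu> a) (trans_guard M (\<pi> i) (\<pi> (Suc i))))}"


section \<open>Syntax\<close>

datatype qvar = Y1 | Y2

datatype tm = Var qvar | ZVar nat | Num nat

type_synonym assignment = "tm \<Rightarrow> nat"

definition is_assignment :: "assignment \<Rightarrow> bool" where
  "is_assignment \<theta> \<longleftrightarrow> (\<forall>k. \<theta> (Num k) = k)"

datatype 'p state_formula =
    Top
  | Atom 'p
  | Neg "'p state_formula"
  | And "'p state_formula" "'p state_formula"
  | Or "'p state_formula" "'p state_formula"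
  | Coal tm tm "'p path_formula"
  | Forall qvar "'p state_formula"
  | Exists qvar "'p state_formula"
and 'p path_formula =
    Next "'p state_formula"
  | Always "'p state_formula"
  | Until "'p state_formula" "'p state_formula"

text \<open>The set of negation depths at which a quantifiable variable occurs free.\<close>

primrec free_depths :: "qvar \<Rightarrow> 'p state_formula \<Rightarrow> nat set"
  and free_depths_path :: "qvar \<Rightarrow> 'p path_formula \<Rightarrow> nat set" where
  "free_depths y Top = {}"
| "free_depths y (Atom p) = {}"
| "free_depths y (Neg \<phi>) = Suc ` free_depths y \<phi>"
| "free_depths y (And \<phi> \<psi>) = free_depths y \<phi> \<union> free_depths y \<psi>"
| "free_depths y (Or \<phi> \<psi>) = free_depths y \<phi> \<union> free_depths y \<psi>"
| "free_depths y (Coal t1 t2 \<chi>) =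
     (if t1 = Var y \<or> t2 = Var y then {0} else {}) \<union> free_depths_path y \<chi>"
| "free_depths y (Forall x \<phi>) = (if x = y then {} else free_depths y \<phi>)"
| "free_depths y (Exists x \<phi>) = (if x = y then {} else free_depths y \<phi>)"
| "free_depths_path y (Next \<phi>) = free_depths y \<phi>"
| "free_depths_path y (Always \<phi>) = free_depths y \<phi>"
| "free_depths_path y (Until \<psi> \<phi>) = free_depths y \<psi> \<union> free_depths y \<phi>"

primrec well_formed :: "'p state_formula \<Rightarrow> bool"
  and well_formed_path :: "'p path_formula \<Rightarrow> bool" where
  "well_formed Top = True"
| "well_formed (Atom p) = True"
| "well_formed (Neg \<phi>) = well_formed \<phi>"
| "well_formed (And \<phi> \<psi>) = (well_formed \<phi> \<and> well_formed \<psi>)"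
| "well_formed (Or \<phi> \<psi>) = (well_formed \<phi> \<and> well_formed \<psi>)"
| "well_formed (Coal t1 t2 \<chi>) = (t1 \<noteq> Var Y2 \<and> t2 \<noteq> Var Y1 \<and> well_formed_path \<chi>)"
| "well_formed (Forall y \<phi>) = (well_formed \<phi> \<and> (\<forall>d\<in>free_depths y \<phi>. even d))"
| "well_formed (Exists y \<phi>) = (well_formed \<phi> \<and> (\<forall>d\<in>free_depths y \<phi>. even d))"
| "well_formed_path (Next \<phi>) = well_formed \<phi>"
| "well_formed_path (Always \<phi>) = well_formed \<phi>"
| "well_formed_path (Until \<psi> \<phi>) = (well_formed \<psi> \<and> well_formed \<phi>)"


section \<open>Normal form\<close>

datatype quantifier = QForall qvar | QExists qvar

text \<open>In \<open>normal_form B qs \<phi>\<close>, \<open>B\<close> collects the variables bound by the quantifiers in whose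
  scope \<open>\<phi>\<close> lies, and \<open>qs\<close> is the block of quantifiers immediately preceding \<open>\<phi>\<close>, innermost
  first. The clause for \<open>Coal\<close> distinguishes whether exactly one or both of
  the two terms are bound variables; a free occurrence imposes no condition.\<close>

primrec normal_form :: "qvar set \<Rightarrow> quantifier list \<Rightarrow> 'p state_formula \<Rightarrow> bool"
  and normal_form_path :: "qvar set \<Rightarrow> 'p path_formula \<Rightarrow> bool" where
  "normal_form B qs Top = True"
| "normal_form B qs (Atom p) = True"
| "normal_form B qs (Neg \<phi>) = normal_form B [] \<phi>"
| "normal_form B qs (And \<phi> \<psi>) = (normal_form B [] \<phi> \<and> normal_form B [] \<psi>)"
| "normal_form B qs (Or \<phi> \<psi>) = (normal_form B [] \<phi> \<and> normal_form B [] \<psi>)"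
| "normal_form B qs (Coal t1 t2 \<chi>) =
    (let b1 = (t1 = Var Y1 \<and> Y1 \<in> B); b2 = (t2 = Var Y2 \<and> Y2 \<in> B) in
      (b1 \<and> \<not> b2 \<longrightarrow> take 1 qs = [QExists Y1]) \<and>
      (b2 \<and> \<not> b1 \<longrightarrow> take 1 qs = [QForall Y2]) \<and>
      (b1 \<and> b2 \<longrightarrow> take 2 qs = [QExists Y1, QForall Y2] \<or> take 2 qs = [QForall Y2, QExists Y1]) \<and>
      normal_form_path B \<chi>)"
| "normal_form B qs (Forall y \<phi>) = (y \<noteq> Y1 \<and> normal_form (insert y B) (QForall y # qs) \<phi>)"
| "normal_form B qs (Exists y \<phi>) = (y \<noteq> Y2 \<and> normal_form (insert y B) (QExists y # qs) \<phi>)"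
| "normal_form_path B (Next \<phi>) = normal_form B [] \<phi>"
| "normal_form_path B (Always \<phi>) = normal_form B [] \<phi>"
| "normal_form_path B (Until \<psi> \<phi>) = (normal_form B [] \<psi> \<and> normal_form B [] \<phi>)"

definition in_L0 :: "'p state_formula \<Rightarrow> bool" where
  "in_L0 \<phi> \<longleftrightarrow> well_formed \<phi> \<and> normal_form {} [] \<phi>"


section \<open>Semantics\<close>

primrec sat :: "('ag, 's, 'p) hdmas \<Rightarrow> 'p state_formula \<Rightarrow> 's \<Rightarrow> assignment \<Rightarrow> bool"
  and sat_path :: "('ag, 's, 'p) hdmas \<Rightarrow> 'p path_formula \<Rightarrow> (nat \<Rightarrow> 's) \<Rightarrow> assignment \<Rightarrow> bool" where
  "sat M Top s \<theta> = True"
| "sat M (Atom p) s \<theta> = (p \<in> labels M s)"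
| "sat M (Neg \<phi>) s \<theta> = (\<not> sat M \<phi> s \<theta>)"
| "sat M (And \<phi> \<psi>) s \<theta> = (sat M \<phi> s \<theta> \<and> sat M \<psi> s \<theta>)"
| "sat M (Or \<phi> \<psi>) s \<theta> = (sat M \<phi> s \<theta> \<or> sat M \<psi> s \<theta>)"
| "sat M (Coal t1 t2 \<chi>) s \<theta> =
    (\<exists>\<sigma>. joint_strategy M (\<theta> t1) \<sigma> \<and> (\<forall>\<pi>\<in>outcome_plays M s \<sigma> (\<theta> t2). sat_path M \<chi> \<pi> \<theta>))"
| "sat M (Forall y \<phi>) s \<theta> = (\<forall>m. sat M \<phi> s (\<theta>(Var y := m)))"
| "sat M (Exists y \<phi>) s \<theta> = (\<exists>m. sat M \<phi> s (\<theta>(Var y := m)))"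
| "sat_path M (Next \<phi>) \<pi> \<theta> = sat M \<phi> (\<pi> 1) \<theta>"
| "sat_path M (Always \<phi>) \<pi> \<theta> = (\<forall>i. sat M \<phi> (\<pi> i) \<theta>)"
| "sat_path M (Until \<psi> \<phi>) \<pi> \<theta> = (\<exists>i. sat M \<phi> (\<pi> i) \<theta> \<and> (\<forall>j<i. sat M \<psi> (\<pi> j) \<theta>))"

text \<open>The type argument fixes the types of agents and states over which the models range;
  theorems are polymorphic in both.\<close>

definition equivalent ::
  "('ag, 's, 'p) hdmas itself \<Rightarrow> 'p state_formula \<Rightarrow> 'p state_formula \<Rightarrow> bool" where
  "equivalent T \<phi> \<psi> \<longleftrightarrow>
    (\<forall>(M :: ('ag, 's, 'p) hdmas) s \<theta>.
       is_hdmas M \<and> s \<in> states M \<and> is_assignment \<theta> \<longrightarrow> sat M \<phi> s \<theta> = sat M \<psi> s \<theta>)"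

definition equivalent_fin ::
  "('ag, 's, 'p) hdmas itself \<Rightarrow> 'p state_formula \<Rightarrow> 'p state_formula \<Rightarrow> bool" where
  "equivalent_fin T \<phi> \<psi> \<longleftrightarrow>
    (\<forall>(M :: ('ag, 's, 'p) hdmas) s \<theta>.
       is_hdmas M \<and> finite (states M) \<and> s \<in> states M \<and> is_assignment \<theta> \<longrightarrow>
       sat M \<phi> s \<theta> = sat M \<psi> s \<theta>)"

end

theory Submission
  imports Defs
begin

text \<open>
  Let \<open>W C N\<close> be the set of states where \<open>C\<close> agents enforce the temporal goal against \<open>N\<close>
  opponents. Positional strategies suffice for always and until, so \<open>W C N\<close> is a fixpoint of the
  one-step controllable predecessor operator; for until, finite branching makes natural-number
  ranks sufficient. Guards do not see idling agents, so \<open>W C N\<close> grows with \<open>C\<close> and shrinks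
  with \<open>N\<close>. Over finitely many states the unions over \<open>C\<close> and the intersections over \<open>N\<close> are
  therefore attained at a single index, which lets the quantifiers commute with the one-step
  operator. Finally, the normal form forces the operands of a quantified temporal
  formula to be independent of the variables quantified in front of it.
\<close>

section \<open>Unfolding monotone families of fixpoints\<close>

text \<open>Any finite subset of the union already lies in one member: of two members of a chain,
  the one with the larger index contains both. The union itself is such a subset.\<close>

lemma mono_Union_attained:
  fixes A :: "nat \<Rightarrow> 'a set"
  assumes "mono A" and "finite (\<Union>n. A n)"
  shows "\<exists>n. (\<Union>m. A m) = A n"
proof -
  have "\<exists>n. X \<subseteq> A n" if "finite X" "X \<subseteq> (\<Union>n. A n)" for X
    using that
  proof (induction X rule: finite_induct)
    case (insert x X)
    then obtain m n where "X \<subseteq> A m" "x \<in> A n" by auto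
    moreover have "A m \<subseteq> A (max m n)" "A n \<subseteq> A (max m n)"
      using \<open>mono A\<close> by (simp_all add: monoD)
    ultimately have "insert x X \<subseteq> A (max m n)" by auto
    then show ?case ..
  qed simp
  then show ?thesis using assms(2) by (metis Sup_upper UNIV_I image_eqI subset_antisym order_refl)
qed

text \<open>Complementation inside the finite set \<open>A 0\<close> turns the decreasing chain into
  an increasing one, to which the statement on unions applies.\<close>

lemma antimono_Inter_attained:
  fixes A :: "nat \<Rightarrow> 'a set"
  assumes "antimono A" and "finite (A 0)"
  shows "\<exists>n. (\<Inter>m. A m) = A n"
proof -
  have "mono (\<lambda>n. A 0 - A n)"
    using \<open>antimono A\<close> by (auto simp: mono_def antimono_def)
  moreover have "finite (\<Union>n. A 0 - A n)"
    by (rule finite_subset[OF _ assms(2)]) auto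
  ultimately obtain n where n: "(\<Union>m. A 0 - A m) = A 0 - A n"
    using mono_Union_attained by blast
  have "A m \<subseteq> A 0" for m
    using \<open>antimono A\<close> by (simp add: antimonoD)
  with n have "(\<Inter>m. A m) = A n" by blast
  then show ?thesis ..
qed

text \<open>Isolates what always and until have in common, with \<open>C\<close> the number of
  controllable agents, \<open>N\<close> the number of opponents and \<open>Q\<close> the one-step
  operator. Always takes \<open>F\<close> empty and its goal for \<open>P\<close>; until takes its
  goal for \<open>F\<close> and its left operand for \<open>P\<close>. Since \<open>unfold\<close>
  only asks for a fixpoint, greatest and least fixpoints are treated alike.\<close>

locale fixpoint_family =
  fixes S F P :: "'a set"
    and Q :: "nat \<Rightarrow> nat \<Rightarrow> 'a set \<Rightarrow> 'a set"
    and W :: "nat \<Rightarrow> nat \<Rightarrow> 'a set"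
  assumes finite_S: "finite S"
    and W_subset: "W C N \<subseteq> S"
    and W_mono: "C \<le> C' \<Longrightarrow> N' \<le> N \<Longrightarrow> W C N \<subseteq> W C' N'"
    and Q_mono: "C \<le> C' \<Longrightarrow> N' \<le> N \<Longrightarrow> X \<subseteq> Y \<Longrightarrow> Q C N X \<subseteq> Q C' N' Y"
    and unfold: "W C N = F \<union> (P \<inter> Q C N (W C N))"
begin

lemma Union_attained: "\<exists>C. (\<Union>C. W C N) = W C N"
proof (rule mono_Union_attained)
  show "mono (\<lambda>C. W C N)" by (auto intro!: monoI dest: W_mono[THEN subsetD, rotated 2])
  show "finite (\<Union>C. W C N)" using W_subset by (auto intro: finite_subset[OF _ finite_S])
qed

lemma Inter_attained: "\<exists>N. (\<Inter>N. W C N) = W C N"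
proof (rule antimono_Inter_attained)
  show "antimono (\<lambda>N. W C N)" by (auto intro!: antimonoI dest: W_mono[THEN subsetD, rotated 2])
  show "finite (W C 0)" by (rule finite_subset[OF W_subset finite_S])
qed

lemma Union_Inter_attained: "\<exists>C. (\<Union>C. \<Inter>N. W C N) = (\<Inter>N. W C N)"
proof (rule mono_Union_attained)
  show "mono (\<lambda>C. \<Inter>N. W C N)" by (auto intro!: monoI dest: W_mono[THEN subsetD, rotated 2])
  show "finite (\<Union>C. \<Inter>N. W C N)"
    by (rule finite_subset[OF _ finite_S]) (use W_subset in blast)
qed

lemma Inter_Union_attained: "\<exists>N. (\<Inter>N. \<Union>C. W C N) = (\<Union>C. W C N)"
proof (rule antimono_Inter_attained)
  show "antimono (\<lambda>N. \<Union>C. W C N)" by (fastforce intro!: antimonoI dest: W_mono[THEN subsetD, rotated 2])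
  show "finite (\<Union>C. W C 0)" using W_subset by (auto intro: finite_subset[OF _ finite_S])
qed

lemma Q_W_subset: "P \<inter> Q C N (W C N) \<subseteq> W C N"
  by (subst (2) unfold) (rule Un_upper2)

lemma F_subset: "F \<subseteq> W C N"
  by (subst unfold) (rule Un_upper1)

lemma unfold_Union: "(\<Union>C. W C N) = F \<union> (P \<inter> (\<Union>C. Q C N (\<Union>C'. W C' N)))"
proof
  show "(\<Union>C. W C N) \<subseteq> F \<union> (P \<inter> (\<Union>C. Q C N (\<Union>C'. W C' N)))"
  proof (rule UN_least)
    fix C
    have "Q C N (W C N) \<subseteq> Q C N (\<Union>C'. W C' N)" by (rule Q_mono) auto
    then show "W C N \<subseteq> F \<union> (P \<inter> (\<Union>C. Q C N (\<Union>C'. W C' N)))"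
      using unfold[of C N] by blast
  qed
  \<comment> \<open>Different successors might call for different numbers of agents;
    \<open>C0\<close> serves all of them. With \<open>max C C0\<close> agents both the first move
    and every continuation can be carried out.\<close>
  obtain C0 where C0: "(\<Union>C. W C N) = W C0 N" using Union_attained by blast
  have "P \<inter> Q C N (\<Union>C'. W C' N) \<subseteq> (\<Union>C. W C N)" for C
  proof -
    have "Q C N (W C0 N) \<subseteq> Q (max C C0) N (W (max C C0) N)"
      by (intro Q_mono W_mono) auto
    then show ?thesis using Q_W_subset[of "max C C0" N] unfolding C0[symmetric] by blast
  qed
  then show "F \<union> (P \<inter> (\<Union>C. Q C N (\<Union>C'. W C' N))) \<subseteq> (\<Union>C. W C N)"
    using F_subset[of _ N] by blast
qed

lemma unfold_Inter: "(\<Inter>N. W C N) = F \<union> (P \<inter> (\<Inter>N. Q C N (\<Inter>N'. W C N')))"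
proof
  obtain N0 where N0: "(\<Inter>N. W C N) = W C N0" using Inter_attained by blast
  have "(\<Inter>N. W C N) \<subseteq> F \<union> (P \<inter> Q C N (\<Inter>N'. W C N'))" for N
  proof -
    \<comment> \<open>Unfolding at \<open>max N N0\<close> gives a first move that is good against
      at least \<open>N\<close> opponents and leads into \<open>W C N0\<close>, which is the whole
      intersection.\<close>
    have "Q C (max N N0) (W C (max N N0)) \<subseteq> Q C N (W C N0)"
      by (intro Q_mono W_mono) auto
    then show ?thesis using unfold[of C "max N N0"] unfolding N0[symmetric] by blast
  qed
  then show "(\<Inter>N. W C N) \<subseteq> F \<union> (P \<inter> (\<Inter>N. Q C N (\<Inter>N'. W C N')))"
    by blast
  show "F \<union> (P \<inter> (\<Inter>N. Q C N (\<Inter>N'. W C N'))) \<subseteq> (\<Inter>N. W C N)"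
  proof (rule INT_greatest)
    fix N
    have "Q C N (\<Inter>N'. W C N') \<subseteq> Q C N (W C N)" by (rule Q_mono) auto
    then show "F \<union> (P \<inter> (\<Inter>N. Q C N (\<Inter>N'. W C N'))) \<subseteq> W C N"
      using unfold[of C N] by blast
  qed
qed

lemma unfold_Inter_Union:
  "(\<Inter>N. \<Union>C. W C N) = F \<union> (P \<inter> (\<Inter>N. \<Union>C. Q C N (\<Inter>N'. \<Union>C'. W C' N')))"
  (is "?Y = ?R")
proof
  obtain N0 where N0: "?Y = (\<Union>C. W C N0)" using Inter_Union_attained by blast
  have "?Y \<subseteq> F \<union> (P \<inter> (\<Union>C. Q C N ?Y))" for N
  proof -
    \<comment> \<open>From \<open>N0\<close> opponents on, whatever can be won with some number of
      agents lies in \<open>?Y\<close>. Hence unfolding at \<open>max N N0\<close> lands in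
      \<open>?Y\<close> after one step.\<close>
    have "W C (max N N0) \<subseteq> ?Y" for C
      unfolding N0 using W_mono[of C C N0 "max N N0"] by auto
    then have "Q C (max N N0) (W C (max N N0)) \<subseteq> Q C N ?Y" for C
      by (intro Q_mono) auto
    then have "W C (max N N0) \<subseteq> F \<union> (P \<inter> (\<Union>C. Q C N ?Y))" for C
      using unfold[of C "max N N0"] by blast
    then show ?thesis by blast
  qed
  then show "?Y \<subseteq> ?R" by blast
  show "?R \<subseteq> ?Y"
  proof (rule INT_greatest)
    fix N
    have "Q C N ?Y \<subseteq> Q C N (\<Union>C. W C N)" for C by (rule Q_mono) auto
    then have "?R \<subseteq> F \<union> (P \<inter> (\<Union>C. Q C N (\<Union>C. W C N)))" by blast
    then show "?R \<subseteq> (\<Union>C. W C N)" by (simp flip: unfold_Union)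
  qed
qed

text \<open>From left to right, \<open>unfold_Inter\<close> is applied for each fixed
  \<open>C\<close>. From right to left, a number \<open>C0\<close> that attains the union is
  combined with the number used in the first step; the maximum works against every \<open>N\<close>
  at once.\<close>

lemma unfold_Union_Inter:
  "(\<Union>C. \<Inter>N. W C N) = F \<union> (P \<inter> (\<Union>C. \<Inter>N. Q C N (\<Union>C'. \<Inter>N'. W C' N')))"
  (is "?Y = ?R")
proof
  have "(\<Inter>N. W C N) \<subseteq> ?R" for C
  proof -
    have "Q C N (\<Inter>N'. W C N') \<subseteq> Q C N ?Y" for N by (rule Q_mono) auto
    then have "(\<Inter>N. Q C N (\<Inter>N'. W C N')) \<subseteq> (\<Union>C. \<Inter>N. Q C N ?Y)"
      by (intro SUP_upper2[of C] INF_mono') simp_all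
    then show ?thesis
      by (subst unfold_Inter) (rule Un_mono[OF order_refl Int_mono[OF order_refl]])
  qed
  then show "?Y \<subseteq> ?R" by blast
  obtain C0 where C0: "?Y = (\<Inter>N. W C0 N)" using Union_Inter_attained by blast
  have "P \<inter> (\<Inter>N. Q C N ?Y) \<subseteq> ?Y" for C
  proof -
    have "?Y \<subseteq> W (max C C0) N" for N
      unfolding C0 using W_mono[of C0 "max C C0" N N] by auto
    then have "Q C N ?Y \<subseteq> Q (max C C0) N (W (max C C0) N)" for N
      by (intro Q_mono) auto
    then have "P \<inter> (\<Inter>N. Q C N ?Y) \<subseteq> W (max C C0) N" for N
      using Q_W_subset[of "max C C0" N] by blast
    then show ?thesis by blast
  qed
  moreover have "F \<subseteq> ?Y" using F_subset by blast
  ultimately show "?R \<subseteq> ?Y" by blast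
qed

end

section \<open>Enforceable goals\<close>

text \<open>The restriction to \<open>states M\<close> matters because guards into other elements of
  the type are unconstrained.\<close>

definition successors :: "('ag, 's, 'p) hdmas \<Rightarrow> (action \<Rightarrow> nat) \<Rightarrow> nat \<Rightarrow> 's \<Rightarrow> 's set" where
  "successors M \<mu> N s =
    {s' \<in> states M. \<exists>\<nu>\<in>distributions M s N. guard_sat (\<lambda>a. \<mu> a + \<nu> a) (trans_guard M s s')}"

text \<open>The controllable predecessor operator: the distribution \<open>\<mu>\<close> is fixed
  before the opponents choose theirs.\<close>

definition cpre :: "('ag, 's, 'p) hdmas \<Rightarrow> nat \<Rightarrow> nat \<Rightarrow> 's set \<Rightarrow> 's set" where
  "cpre M C N X = {s \<in> states M. \<exists>\<mu>\<in>distributions M s C. successors M \<mu> N s \<subseteq> X}"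

definition enforce :: "('ag, 's, 'p) hdmas \<Rightarrow> nat \<Rightarrow> nat \<Rightarrow> ((nat \<Rightarrow> 's) \<Rightarrow> bool) \<Rightarrow> 's set" where
  "enforce M C N P =
    {s \<in> states M. \<exists>\<sigma>. joint_strategy M C \<sigma> \<and> (\<forall>\<pi>\<in>outcome_plays M s \<sigma> N. P \<pi>)}"

definition always :: "'s set \<Rightarrow> (nat \<Rightarrow> 's) \<Rightarrow> bool" where
  "always F \<pi> \<longleftrightarrow> (\<forall>i. \<pi> i \<in> F)"

definition until :: "'s set \<Rightarrow> 's set \<Rightarrow> (nat \<Rightarrow> 's) \<Rightarrow> bool" where
  "until P F \<pi> \<longleftrightarrow> (\<exists>i. \<pi> i \<in> F \<and> (\<forall>j<i. \<pi> j \<in> P))"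

lemma cpre_mono: "X \<subseteq> Y \<Longrightarrow> cpre M C N X \<subseteq> cpre M C N Y"
  unfolding cpre_def by blast

lemma outcome_plays_iff:
  "\<pi> \<in> outcome_plays M s \<sigma> N \<longleftrightarrow>
    s \<in> states M \<and> \<pi> 0 = s \<and> (\<forall>i. \<pi> (Suc i) \<in> successors M (\<sigma> (\<pi> i)) N (\<pi> i))"
proof -
  have "(\<forall>i. \<pi> i \<in> states M) \<longleftrightarrow> \<pi> 0 \<in> states M \<and> (\<forall>i. \<pi> (Suc i) \<in> states M)"
    by (metis not0_implies_Suc)
  then show ?thesis unfolding outcome_plays_def successors_def by auto
qed

text \<open>Strategies are positional, so a legal first move followed by a play that obeys
  \<open>\<sigma>\<close> obeys \<open>\<sigma>\<close> as a whole.\<close>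

lemma outcome_plays_Cons:
  assumes "s \<in> states M" and "s' \<in> successors M (\<sigma> s) N s" and "\<pi> \<in> outcome_plays M s' \<sigma> N"
  shows "case_nat s \<pi> \<in> outcome_plays M s \<sigma> N"
  using assms by (auto simp: outcome_plays_iff split: nat.split)

section \<open>Idle agents, finite branching and monotonicity in the numbers of agents\<close>

lemma pterm_val_cong: "(\<And>i. \<nu> (Act i) = \<nu>' (Act i)) \<Longrightarrow> pterm_val \<nu> b = pterm_val \<nu>' b"
  by (induction b) auto

text \<open>Guards read only the counts at \<open>Act i\<close>, so a change at \<open>Idle\<close>
  is invisible to them. All monotonicity in the numbers of agents comes from here.\<close>

lemma guard_sat_cong:
  assumes "\<And>i. \<nu> (Act i) = \<nu>' (Act i)"
  shows "guard_sat \<nu> g = guard_sat \<nu>' g"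
  by (induction g) (simp_all add: pterm_val_cong[of \<nu> \<nu>', OF assms])

locale hdmas_model =
  fixes M :: "('ag, 's, 'p) hdmas"
  assumes hdmas: "is_hdmas M"
begin

lemma avail: "s \<in> states M \<Longrightarrow> finite (avail M s) \<and> Idle \<in> avail M s"
  using hdmas unfolding is_hdmas_def all_actions_def
  by (metis finite_atLeastAtMost finite_imageI finite_insert finite_subset)

lemma add_idle:
  assumes "s \<in> states M" and "\<nu> \<in> distributions M s k"
  shows "\<nu>(Idle := \<nu> Idle + j) \<in> distributions M s (k + j)"
proof -
  have "sum (\<nu>(Idle := \<nu> Idle + j)) (avail M s) = sum \<nu> (avail M s) + j"
    using avail[OF assms(1)] by (simp add: sum.remove[of _ Idle])
  then show ?thesis using assms avail[OF assms(1)]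
    unfolding distributions_def counts_def by auto
qed

lemma distributions_nonempty: "s \<in> states M \<Longrightarrow> \<exists>\<nu>. \<nu> \<in> distributions M s k"
  \<comment> \<open>The witness starts from the empty distribution of no agents and lets all
    \<open>k\<close> agents idle.\<close>
  using add_idle[of s "\<lambda>_. 0" 0 k] by (auto simp: distributions_def counts_def)

lemma distributions_finite:
  assumes "s \<in> states M"
  shows "finite (distributions M s k)"
proof (rule finite_subset)
  show "distributions M s k \<subseteq>
      {\<nu>. \<forall>a. (a \<in> avail M s \<longrightarrow> \<nu> a \<in> {..k}) \<and> (a \<notin> avail M s \<longrightarrow> \<nu> a = 0)}"
    using avail[OF assms] by (auto simp: distributions_def counts_def intro: member_le_sum)
  show "finite {\<nu>. \<forall>a. (a \<in> avail M s \<longrightarrow> \<nu> a \<in> {..k}) \<and> (a \<notin> avail M s \<longrightarrow> \<nu> a = 0)}"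
    by (rule finite_set_of_finite_funs) (use avail[OF assms] in simp_all)
qed

lemma unique_successor:
  assumes "s \<in> states M" "\<mu> \<in> distributions M s C" "\<nu> \<in> distributions M s N"
  shows "\<exists>!s'. s' \<in> states M \<and> guard_sat (\<lambda>a. \<mu> a + \<nu> a) (trans_guard M s s')"
proof -
  have "(\<lambda>a. \<mu> a + \<nu> a) \<in> counts M s"
    using assms by (auto simp: distributions_def counts_def)
  then show ?thesis using assms(1) hdmas unfolding is_hdmas_def by blast
qed

lemma successors_nonempty:
  assumes "s \<in> states M" "\<mu> \<in> distributions M s C"
  shows "\<exists>s'. s' \<in> successors M \<mu> N s"
  using distributions_nonempty[OF assms(1), of N] unique_successor[OF assms]
  unfolding successors_def by blast

text \<open>Finite branching: each of the finitely many distributions of the opponents determines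
  its successor. This holds over infinite state spaces as well.\<close>

lemma successors_finite:
  assumes "s \<in> states M" "\<mu> \<in> distributions M s C"
  shows "finite (successors M \<mu> N s)"
proof (rule finite_surj[OF distributions_finite[OF assms(1)]])
  show "successors M \<mu> N s \<subseteq>
      (\<lambda>\<nu>. THE s'. s' \<in> states M \<and> guard_sat (\<lambda>a. \<mu> a + \<nu> a) (trans_guard M s s')) ` distributions M s N"
    using unique_successor[OF assms] unfolding successors_def
    by (fastforce intro!: image_eqI the1_equality[symmetric])
qed

text \<open>The additional \<open>N' - N\<close> opponents can idle, which leaves the satisfied
  guard unchanged.\<close>

lemma successors_mono:
  assumes "s \<in> states M" "N \<le> N'"
  shows "successors M \<mu> N s \<subseteq> successors M \<mu> N' s"
proof
  fix s' assume "s' \<in> successors M \<mu> N s"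
  then obtain \<nu> where \<nu>: "s' \<in> states M" "\<nu> \<in> distributions M s N"
    "guard_sat (\<lambda>a. \<mu> a + \<nu> a) (trans_guard M s s')"
    unfolding successors_def by blast
  let ?\<nu> = "\<nu>(Idle := \<nu> Idle + (N' - N))"
  have "?\<nu> \<in> distributions M s N'"
    using add_idle[OF assms(1) \<nu>(2), of "N' - N"] assms(2) by simp
  moreover have "guard_sat (\<lambda>a. \<mu> a + ?\<nu> a) (trans_guard M s s')"
    using \<nu>(3) by (subst guard_sat_cong) auto
  ultimately show "s' \<in> successors M \<mu> N' s"
    using \<nu>(1) unfolding successors_def by blast
qed

lemma successors_add_idle: "successors M (\<mu>(Idle := k)) N s = successors M \<mu> N s"
proof -
  have "guard_sat (\<lambda>a. (\<mu>(Idle := k)) a + \<nu> a) g = guard_sat (\<lambda>a. \<mu> a + \<nu> a) g" for \<nu> g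
    by (rule guard_sat_cong) simp
  then show ?thesis unfolding successors_def by simp
qed

text \<open>Plays never get stuck. Since enforcing quantifies universally over plays, this is what
  allows facts about single states to be read off from a winning strategy.\<close>

lemma outcome_plays_nonempty:
  assumes "s \<in> states M" "joint_strategy M C \<sigma>"
  shows "\<exists>\<pi>. \<pi> \<in> outcome_plays M s \<sigma> N"
proof -
  have "\<exists>\<pi>. \<forall>n. (\<pi> n \<in> states M \<and> (n = 0 \<longrightarrow> \<pi> n = s)) \<and> \<pi> (Suc n) \<in> successors M (\<sigma> (\<pi> n)) N (\<pi> n)"
  proof (rule dependent_nat_choice)
    show "\<exists>x. x \<in> states M \<and> (0 = (0::nat) \<longrightarrow> x = s)" using assms(1) by blast
    show "\<exists>y. (y \<in> states M \<and> (Suc n = 0 \<longrightarrow> y = s)) \<and> y \<in> successors M (\<sigma> x) N x"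
      if "x \<in> states M \<and> (n = 0 \<longrightarrow> x = s)" for x n
      using successors_nonempty[of x "\<sigma> x" C N] assms(2) that
      by (auto simp: joint_strategy_def successors_def)
  qed
  then show ?thesis using assms(1) by (auto simp: outcome_plays_iff)
qed

lemma enforce_mono:
  assumes "C \<le> C'" "N' \<le> N"
  shows "enforce M C N P \<subseteq> enforce M C' N' P"
proof
  fix s assume "s \<in> enforce M C N P"
  then obtain \<sigma> where s: "s \<in> states M" and \<sigma>: "joint_strategy M C \<sigma>"
    "\<And>\<pi>. \<pi> \<in> outcome_plays M s \<sigma> N \<Longrightarrow> P \<pi>"
    unfolding enforce_def by blast
  \<comment> \<open>Surplus agents idle in every state. A play of the padded strategy against
    \<open>N'\<close> opponents is then also a play of \<open>\<sigma>\<close> against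
    \<open>N\<close> opponents.\<close>
  let ?\<sigma> = "\<lambda>s. (\<sigma> s)(Idle := \<sigma> s Idle + (C' - C))"
  have strategy: "joint_strategy M C' ?\<sigma>"
    using \<sigma>(1) add_idle[of _ _ C "C' - C"] assms(1) unfolding joint_strategy_def by simp
  have wins: "P \<pi>" if "\<pi> \<in> outcome_plays M s ?\<sigma> N'" for \<pi>
  proof (rule \<sigma>(2))
    have "\<pi> i \<in> states M" for i using that unfolding outcome_plays_def by auto
    from successors_mono[OF this assms(2)]
    have "\<pi> (Suc i) \<in> successors M (\<sigma> (\<pi> i)) N (\<pi> i)" for i
      using that unfolding outcome_plays_iff successors_add_idle by blast
    then show "\<pi> \<in> outcome_plays M s \<sigma> N" using that by (simp add: outcome_plays_iff)
  qed
  show "s \<in> enforce M C' N' P"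
    unfolding enforce_def by (intro CollectI conjI exI[of _ ?\<sigma>] ballI s strategy wins)
qed

text \<open>A positional strategy is glued together from independent local choices; at states
  outside \<open>X\<close> any distribution serves as the default.\<close>

lemma strategy_extends:
  assumes "\<And>s. s \<in> X \<Longrightarrow> \<exists>\<mu>\<in>distributions M s C. R s \<mu>"
  shows "\<exists>\<sigma>. joint_strategy M C \<sigma> \<and> (\<forall>s\<in>X. R s (\<sigma> s))"
proof -
  have "\<forall>s. \<exists>\<mu>. (s \<in> states M \<longrightarrow> \<mu> \<in> distributions M s C) \<and> (s \<in> X \<longrightarrow> R s \<mu>)"
    using assms distributions_nonempty by metis
  then show ?thesis unfolding joint_strategy_def by metis
qed

lemma enforce_next: "enforce M C N (\<lambda>\<pi>. \<pi> 1 \<in> X) = cpre M C N X"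
proof
  show "enforce M C N (\<lambda>\<pi>. \<pi> 1 \<in> X) \<subseteq> cpre M C N X"
  proof
    fix s assume "s \<in> enforce M C N (\<lambda>\<pi>. \<pi> 1 \<in> X)"
    then obtain \<sigma> where s: "s \<in> states M" and \<sigma>: "joint_strategy M C \<sigma>"
      "\<And>\<pi>. \<pi> \<in> outcome_plays M s \<sigma> N \<Longrightarrow> \<pi> 1 \<in> X"
      unfolding enforce_def by blast
    have "s' \<in> X" if s': "s' \<in> successors M (\<sigma> s) N s" for s'
    proof -
      have "s' \<in> states M" using s' by (simp add: successors_def)
      \<comment> \<open>The assumption on \<open>\<sigma>\<close> speaks of infinite plays only, so
        the successor \<open>s'\<close> has to be extended to one.\<close>
      then obtain \<pi> where \<pi>: "\<pi> \<in> outcome_plays M s' \<sigma> N"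
        using outcome_plays_nonempty[OF _ \<sigma>(1)] by blast
      then show ?thesis
        using \<sigma>(2)[OF outcome_plays_Cons[OF s s' \<pi>]] by (simp add: outcome_plays_iff)
    qed
    then show "s \<in> cpre M C N X"
      using s \<sigma>(1) unfolding cpre_def joint_strategy_def by blast
  qed
  show "cpre M C N X \<subseteq> enforce M C N (\<lambda>\<pi>. \<pi> 1 \<in> X)"
  proof
    fix s assume s: "s \<in> cpre M C N X"
    then obtain \<sigma> where "joint_strategy M C \<sigma>" "successors M (\<sigma> s) N s \<subseteq> X"
      using strategy_extends[of "{s}" C "\<lambda>s \<mu>. successors M \<mu> N s \<subseteq> X"]
      unfolding cpre_def by blast
    moreover have "\<pi> 1 \<in> X" if "\<pi> \<in> outcome_plays M s \<sigma> N" for \<pi>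
      using that calculation(2) unfolding outcome_plays_iff One_nat_def by blast
    ultimately show "s \<in> enforce M C N (\<lambda>\<pi>. \<pi> 1 \<in> X)"
      using s unfolding enforce_def cpre_def by blast
  qed
qed

lemma cpre_mono_agents:
  assumes "C \<le> C'" "N' \<le> N" "X \<subseteq> Y"
  shows "cpre M C N X \<subseteq> cpre M C' N' Y"
  using enforce_mono[OF assms(1,2), of "\<lambda>\<pi>. \<pi> 1 \<in> X"] cpre_mono[OF assms(3)]
  unfolding enforce_next by blast

text \<open>The strategy that wins from \<open>s\<close> is reused, unchanged, as the witness at
  every successor.\<close>

lemma enforce_tail:
  assumes s: "s \<in> states M" and \<sigma>: "joint_strategy M C \<sigma>"
    and tl: "\<And>s' \<pi>. s' \<in> successors M (\<sigma> s) N s \<Longrightarrow> \<pi> \<in> outcome_plays M s' \<sigma> N \<Longrightarrow> P \<pi>"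
  shows "s \<in> cpre M C N (enforce M C N P)"
proof -
  have "successors M (\<sigma> s) N s \<subseteq> enforce M C N P"
    using \<sigma> tl unfolding enforce_def by (auto simp: successors_def)
  then show ?thesis using s \<sigma> unfolding cpre_def joint_strategy_def by blast
qed

section \<open>Safety goals as a greatest fixpoint\<close>

text \<open>From each state of \<open>X\<close> some move keeps the play in \<open>X\<close>. Gluing
  these moves gives a strategy under which the play never leaves \<open>X\<close>, and
  \<open>X\<close> lies inside \<open>F\<close>.\<close>

lemma enforce_always_coinduct:
  assumes "X \<subseteq> F \<inter> cpre M C N X"
  shows "X \<subseteq> enforce M C N (always F)"
proof
  fix s assume s: "s \<in> X"
  have "\<exists>\<mu>\<in>distributions M s C. successors M \<mu> N s \<subseteq> X" if "s \<in> X" for s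
    using that assms unfolding cpre_def by blast
  then obtain \<sigma> where \<sigma>: "joint_strategy M C \<sigma>" "\<And>s. s \<in> X \<Longrightarrow> successors M (\<sigma> s) N s \<subseteq> X"
    using strategy_extends[of X C "\<lambda>s \<mu>. successors M \<mu> N s \<subseteq> X"] by blast
  have "always F \<pi>" if \<pi>: "\<pi> \<in> outcome_plays M s \<sigma> N" for \<pi>
  proof -
    have "\<pi> i \<in> X" for i
      by (induction i) (use \<pi> s \<sigma>(2) in \<open>auto simp: outcome_plays_iff\<close>)
    then show ?thesis using assms unfolding always_def by blast
  qed
  moreover have "s \<in> states M" using s assms unfolding cpre_def by blast
  ultimately show "s \<in> enforce M C N (always F)"
    using \<sigma>(1) unfolding enforce_def by blast
qed

lemma enforce_always_unfold:
  "enforce M C N (always F) = F \<inter> cpre M C N (enforce M C N (always F))" (is "?W = ?R")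
proof
  show sub: "?W \<subseteq> ?R"
  proof
    fix s assume "s \<in> ?W"
    then obtain \<sigma> where s: "s \<in> states M" and \<sigma>: "joint_strategy M C \<sigma>"
      "\<And>\<pi>. \<pi> \<in> outcome_plays M s \<sigma> N \<Longrightarrow> always F \<pi>"
      unfolding enforce_def by blast
    obtain \<pi> where "\<pi> \<in> outcome_plays M s \<sigma> N"
      using outcome_plays_nonempty[OF s \<sigma>(1)] by blast
    then have "s \<in> F" using \<sigma>(2)[of \<pi>] by (auto simp: always_def outcome_plays_iff)
    moreover have "s \<in> cpre M C N ?W"
    proof (rule enforce_tail[OF s \<sigma>(1)])
      fix s' \<pi> assume "s' \<in> successors M (\<sigma> s) N s" "\<pi> \<in> outcome_plays M s' \<sigma> N"
      then have "always F (case_nat s \<pi>)"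
        using \<sigma>(2) outcome_plays_Cons[OF s] by blast
      then show "always F \<pi>" unfolding always_def by (metis nat.case(2))
    qed
    ultimately show "s \<in> ?R" by blast
  qed
  \<comment> \<open>States of \<open>?R\<close> can be forced into \<open>?W\<close>, and
    \<open>?W\<close> lies in \<open>?R\<close>, so the union of both is a post-fixpoint and
    coinduction applies to it.\<close>
  have "?R \<union> ?W \<subseteq> ?W"
  proof (rule enforce_always_coinduct)
    have "cpre M C N ?W \<subseteq> cpre M C N (?R \<union> ?W)" by (rule cpre_mono) blast
    then show "?R \<union> ?W \<subseteq> F \<inter> cpre M C N (?R \<union> ?W)" using sub by blast
  qed
  then show "?R \<subseteq> ?W" by blast
qed

section \<open>Until goals as a least fixpoint reached through finite stages\<close>

text \<open>The finite stages of the least fixpoint iteration; the first stage that contains a state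
  is its rank. The previous stage is kept explicitly, which makes the chain increasing by
  construction.\<close>

primrec attractor :: "nat \<Rightarrow> nat \<Rightarrow> 's set \<Rightarrow> 's set \<Rightarrow> nat \<Rightarrow> 's set" where
  "attractor C N P F 0 = states M \<inter> F"
| "attractor C N P F (Suc n) =
     attractor C N P F n \<union> (P \<inter> cpre M C N (attractor C N P F n))"

lemma attractor_mono: "mono (attractor C N P F)"
  unfolding mono_iff_le_Suc by simp

lemma attractor_states: "attractor C N P F n \<subseteq> states M"
  by (induction n) (auto simp: cpre_def)

text \<open>Continuity along increasing chains: the finitely many successors under a fixed
  \<open>\<mu>\<close> are all caught by one member. No transfinite stages are therefore required
  for until.\<close>

lemma cpre_Union_mono:
  assumes "mono A"
  shows "cpre M C N (\<Union>n::nat. A n) \<subseteq> (\<Union>n. cpre M C N (A n))"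
proof
  fix s assume "s \<in> cpre M C N (\<Union>n. A n)"
  then obtain \<mu> where s: "s \<in> states M" and \<mu>: "\<mu> \<in> distributions M s C"
    "successors M \<mu> N s \<subseteq> (\<Union>n. A n)"
    unfolding cpre_def by blast
  let ?A = "\<lambda>n. successors M \<mu> N s \<inter> A n"
  have "mono ?A" using assms unfolding mono_def by blast
  moreover have "finite (\<Union>n. ?A n)"
    by (rule finite_subset[OF _ successors_finite[OF s \<mu>(1)]]) blast
  ultimately obtain n where "(\<Union>n. ?A n) = ?A n" using mono_Union_attained by blast
  then have "successors M \<mu> N s \<subseteq> A n" using \<mu>(2) by blast
  then show "s \<in> (\<Union>n. cpre M C N (A n))" using s \<mu>(1) unfolding cpre_def by blast
qed

lemma attractor_subset_enforce: "attractor C N P F n \<subseteq> enforce M C N (until P F)"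
proof -
  let ?A = "attractor C N P F"
  \<comment> \<open>A move that lowers the rank. Quantifying over all \<open>n\<close> inside
    \<open>R\<close> yields a single positional strategy for all stages; states of rank zero or of
    no rank are unrestricted.\<close>
  define R where "R s \<mu> \<longleftrightarrow> (\<forall>n. s \<in> ?A (Suc n) - ?A n \<longrightarrow> s \<in> P \<and> successors M \<mu> N s \<subseteq> ?A n)"
    for s \<mu>
  have "\<exists>\<mu>\<in>distributions M s C. R s \<mu>" if s: "s \<in> states M" for s
  proof (cases "\<exists>n. s \<in> ?A (Suc n) - ?A n")
    case True
    then obtain n where n: "s \<in> ?A (Suc n) - ?A n" by blast
    then have "s \<in> P" "s \<in> cpre M C N (?A n)" by auto
    then obtain \<mu> where \<mu>: "\<mu> \<in> distributions M s C" "successors M \<mu> N s \<subseteq> ?A n"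
      unfolding cpre_def by blast
    \<comment> \<open>A state enters the increasing chain only once, so the move chosen for
      \<open>n\<close> meets the condition for every index.\<close>
    have uniq: "m = n" if "s \<in> ?A (Suc m) - ?A m" for m
    proof (rule ccontr)
      assume "m \<noteq> n"
      then have "Suc m \<le> n \<or> Suc n \<le> m" by auto
      then show False
        using that n monoD[OF attractor_mono, of "Suc m" n C N P F]
          monoD[OF attractor_mono, of "Suc n" m C N P F] by blast
    qed
    have "R s \<mu>" unfolding R_def using uniq \<open>s \<in> P\<close> \<mu>(2) by blast
    then show ?thesis using \<mu>(1) by blast
  next
    case False
    then show ?thesis unfolding R_def using distributions_nonempty[OF s] by blast
  qed
  then obtain \<sigma> where \<sigma>: "joint_strategy M C \<sigma>" "\<And>s. s \<in> states M \<Longrightarrow> R s (\<sigma> s)"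
    using strategy_extends[of "states M" C R] by blast
  have "until P F \<pi>" if "s \<in> ?A n" "\<pi> \<in> outcome_plays M s \<sigma> N" for s n \<pi>
    using that
  proof (induction n arbitrary: s \<pi>)
    case 0
    then show ?case unfolding until_def by (auto simp: outcome_plays_iff intro!: exI[of _ 0])
  next
    case (Suc n)
    show ?case
    proof (cases "s \<in> ?A n")
      case True
      then show ?thesis using Suc by blast
    next
      case False
      have s: "s \<in> states M" "\<pi> 0 = s" and \<pi>: "\<pi> (Suc i) \<in> successors M (\<sigma> (\<pi> i)) N (\<pi> i)" for i
        using Suc.prems(2) by (auto simp: outcome_plays_iff)
      have "s \<in> P" "\<pi> 1 \<in> ?A n"
        using \<sigma>(2)[OF s(1)] False Suc.prems(1) \<pi>[of 0] s(2) unfolding R_def by auto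
      \<comment> \<open>The tail of the play obeys the same positional strategy and starts at a
        smaller rank, as the induction hypothesis requires.\<close>
      moreover have "\<pi> \<circ> Suc \<in> outcome_plays M (\<pi> 1) \<sigma> N"
        using \<pi> \<pi>[of 0] by (auto simp: outcome_plays_iff successors_def)
      ultimately have "until P F (\<pi> \<circ> Suc)" using Suc.IH by blast
      then obtain i where "\<pi> (Suc i) \<in> F" "\<forall>j<i. \<pi> (Suc j) \<in> P"
        unfolding until_def by auto
      moreover have "\<forall>j<Suc i. \<pi> j \<in> P"
        using \<open>s \<in> P\<close> s(2) calculation(2) by (auto simp: less_Suc_eq_0_disj)
      ultimately show ?thesis unfolding until_def by blast
    qed
  qed
  then show ?thesis
    using \<sigma>(1) attractor_states[of C N P F n] unfolding enforce_def by blast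
qed

text \<open>From a state outside all stages, every strategy admits a play that avoids them for as
  long as it has stayed in \<open>P\<close>. Stage zero contains every state of \<open>F\<close>, so
  such a play violates the until goal.\<close>

lemma enforce_until_subset_attractor:
  "enforce M C N (until P F) \<subseteq> (\<Union>n. attractor C N P F n)" (is "_ \<subseteq> ?A")
proof (rule subsetI, rule ccontr)
  fix s assume "s \<in> enforce M C N (until P F)" and sA: "s \<notin> ?A"
  then obtain \<sigma> where s: "s \<in> states M" and \<sigma>: "joint_strategy M C \<sigma>"
    "\<And>\<pi>. \<pi> \<in> outcome_plays M s \<sigma> N \<Longrightarrow> until P F \<pi>"
    unfolding enforce_def by blast
  have cpre_A: "P \<inter> cpre M C N ?A \<subseteq> ?A"
    using cpre_Union_mono[OF attractor_mono, of C N C N P F] by (fastforce intro: exI[of _ "Suc _"])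
  \<comment> \<open>Avoidance can be demanded only at states of \<open>P - ?A\<close>; elsewhere an
    arbitrary successor continues the play.\<close>
  have step: "\<exists>s'. s' \<in> successors M (\<sigma> s) N s \<and> (s \<in> P - ?A \<longrightarrow> s' \<notin> ?A)"
    if "s \<in> states M" for s
  proof (cases "s \<in> P - ?A")
    case True
    then have "s \<notin> cpre M C N ?A" using cpre_A by blast
    then have "\<not> successors M (\<sigma> s) N s \<subseteq> ?A"
      using that \<sigma>(1) unfolding cpre_def joint_strategy_def by blast
    then show ?thesis by blast
  next
    case False
    then show ?thesis
      using that \<sigma>(1) successors_nonempty unfolding joint_strategy_def by blast
  qed
  have "\<exists>\<pi>. \<forall>n. (\<pi> n \<in> states M \<and> (n = 0 \<longrightarrow> \<pi> n = s)) \<and>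
      (\<pi> (Suc n) \<in> successors M (\<sigma> (\<pi> n)) N (\<pi> n) \<and> (\<pi> n \<in> P - ?A \<longrightarrow> \<pi> (Suc n) \<notin> ?A))"
  proof (rule dependent_nat_choice)
    show "\<exists>x. x \<in> states M \<and> (0 = (0::nat) \<longrightarrow> x = s)" using s by blast
    show "\<exists>y. (y \<in> states M \<and> (Suc n = 0 \<longrightarrow> y = s)) \<and>
        (y \<in> successors M (\<sigma> x) N x \<and> (x \<in> P - ?A \<longrightarrow> y \<notin> ?A))"
      if "x \<in> states M \<and> (n = 0 \<longrightarrow> x = s)" for x n
      using step[of x] that by (auto simp: successors_def)
  qed
  then obtain \<pi> where \<pi>: "\<pi> 0 = s" "\<And>n. \<pi> n \<in> states M"
    "\<And>n. \<pi> (Suc n) \<in> successors M (\<sigma> (\<pi> n)) N (\<pi> n)"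
    "\<And>n. \<pi> n \<in> P - ?A \<Longrightarrow> \<pi> (Suc n) \<notin> ?A"
    by blast
  have "\<pi> \<in> outcome_plays M s \<sigma> N" using \<pi> s by (simp add: outcome_plays_iff)
  then obtain i where i: "\<pi> i \<in> F" "\<And>j. j < i \<Longrightarrow> \<pi> j \<in> P"
    using \<sigma>(2) unfolding until_def by blast
  \<comment> \<open>All positions before \<open>i\<close> lie in \<open>P\<close>, so avoidance
    carries over up to and including \<open>i\<close>, where \<open>F\<close> would put the play
    into stage zero.\<close>
  have "\<pi> j \<notin> ?A" if "j \<le> i" for j
    using that by (induction j) (use \<pi>(1) sA \<pi>(4) i(2) in \<open>auto simp: Suc_le_eq\<close>)
  moreover have "\<pi> i \<in> attractor C N P F 0" using i(1) \<pi>(2) by simp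
  ultimately show False by blast
qed

lemma enforce_until_unfold:
  "enforce M C N (until P F) = states M \<inter> F \<union> (P \<inter> cpre M C N (enforce M C N (until P F)))"
  (is "?W = ?R")
proof
  show "?W \<subseteq> ?R"
  proof
    fix s assume "s \<in> ?W"
    then obtain \<sigma> where s: "s \<in> states M" and \<sigma>: "joint_strategy M C \<sigma>"
      "\<And>\<pi>. \<pi> \<in> outcome_plays M s \<sigma> N \<Longrightarrow> until P F \<pi>"
      unfolding enforce_def by blast
    obtain \<pi> where \<pi>: "\<pi> \<in> outcome_plays M s \<sigma> N"
      using outcome_plays_nonempty[OF s \<sigma>(1)] by blast
    show "s \<in> ?R"
    proof (cases "s \<in> F")
      case False
      obtain i where "\<pi> i \<in> F" "\<forall>j<i. \<pi> j \<in> P" using \<sigma>(2)[OF \<pi>] unfolding until_def by blast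
      moreover have "\<pi> 0 = s" using \<pi> by (simp add: outcome_plays_iff)
      ultimately have "s \<in> P" using False by (metis gr0I)
      moreover have "s \<in> cpre M C N ?W"
      proof (rule enforce_tail[OF s \<sigma>(1)])
        fix s' \<pi> assume "s' \<in> successors M (\<sigma> s) N s" "\<pi> \<in> outcome_plays M s' \<sigma> N"
        then have "until P F (case_nat s \<pi>)"
          using \<sigma>(2) outcome_plays_Cons[OF s] by blast
        then obtain i where i: "case_nat s \<pi> i \<in> F" "\<forall>j<i. case_nat s \<pi> j \<in> P"
          unfolding until_def by blast
        \<comment> \<open>As \<open>s\<close> is not in \<open>F\<close>, the goal is met at a
          positive position, which becomes position \<open>k\<close> of the tail.\<close>
        then obtain k where "i = Suc k" using False by (cases i) auto
        moreover have "\<pi> j \<in> P" if "j < k" for j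
          using i(2)[rule_format, of "Suc j"] \<open>i = Suc k\<close> that by simp
        ultimately show "until P F \<pi>" using i(1) unfolding until_def by auto
      qed
      ultimately show ?thesis by blast
    qed (use s in blast)
  qed
  \<comment> \<open>The passage through the stages assembles the winning strategies of the
    successors into one: continuity places the state itself in some stage
    \<open>Suc n\<close>.\<close>
  have "cpre M C N ?W \<subseteq> cpre M C N (\<Union>n. attractor C N P F n)"
    by (rule cpre_mono[OF enforce_until_subset_attractor])
  also have "\<dots> \<subseteq> (\<Union>n. cpre M C N (attractor C N P F n))"
    by (rule cpre_Union_mono[OF attractor_mono])
  finally have "P \<inter> cpre M C N ?W \<subseteq> (\<Union>n. attractor C N P F (Suc n))"
    by auto
  moreover have "states M \<inter> F \<subseteq> attractor C N P F 0" by simp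
  ultimately have "?R \<subseteq> (\<Union>n. attractor C N P F n)" by blast
  also have "\<dots> \<subseteq> ?W" using attractor_subset_enforce by blast
  finally show "?R \<subseteq> ?W" .
qed

end

section \<open>Independence of the quantified variables\<close>

text \<open>Below a connective or a temporal operator the quantifier block is reset to empty, while
  \<open>y\<close> stays in \<open>B\<close>. An occurrence of \<open>y\<close> in a coalition
  operator would then need a quantifier on \<open>y\<close> immediately in front of it; such a
  quantifier makes the occurrence bound inside the formula.\<close>

lemma normal_form_not_free:
  fixes \<phi> :: "'p state_formula" and \<chi> :: "'p path_formula"
  shows "well_formed \<phi> \<Longrightarrow> normal_form B qs \<phi> \<Longrightarrow> y \<in> B \<Longrightarrow> QForall y \<notin> set qs \<Longrightarrow> QExists y \<notin> set qs
    \<Longrightarrow> free_depths y \<phi> = {}"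
    and "well_formed_path \<chi> \<Longrightarrow> normal_form_path B \<chi> \<Longrightarrow> y \<in> B \<Longrightarrow> free_depths_path y \<chi> = {}"
proof (induction \<phi> and \<chi> arbitrary: B qs and B)
  case (Coal t1 t2 \<chi>)
  have "q \<notin> set (take k qs)" if "q = QForall y \<or> q = QExists y" for q k
    using Coal.prems that in_set_takeD by metis
  then have "take k qs \<noteq> xs" if "QForall y \<in> set xs \<or> QExists y \<in> set xs" for k xs
    using that by blast
  from this[of "[QExists y]" 1] this[of "[QForall y]" 1]
    this[of "[QExists Y1, QForall Y2]" 2] this[of "[QForall Y2, QExists Y1]" 2]
  \<comment> \<open>Both admissible two-quantifier prefixes mention \<open>Y1\<close> as well as
    \<open>Y2\<close>, so each is excluded whichever variable \<open>y\<close> is.\<close>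
  have block: "take 1 qs \<noteq> [QExists y]" "take 1 qs \<noteq> [QForall y]"
    "take 2 qs \<noteq> [QExists Y1, QForall Y2]" "take 2 qs \<noteq> [QForall Y2, QExists Y1]"
    by (cases y; simp)+
  have "t1 \<noteq> Var y \<and> t2 \<noteq> Var y"
  proof (cases y)
    case Y1
    have "t2 \<noteq> Var y" using Coal.prems(1) unfolding Y1 well_formed.simps by blast
    moreover have "t1 \<noteq> Var y" using Coal.prems(2,3) block unfolding Y1 normal_form.simps Let_def by blast
    ultimately show ?thesis by blast
  next
    case Y2
    have "t1 \<noteq> Var y" using Coal.prems(1) unfolding Y2 well_formed.simps by blast
    moreover have "t2 \<noteq> Var y" using Coal.prems(2,3) block unfolding Y2 normal_form.simps Let_def by blast
    ultimately show ?thesis by blast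
  qed
  moreover have "free_depths_path y \<chi> = {}"
    using Coal.IH[of B] Coal.prems(1-3) by (simp add: Let_def)
  ultimately show ?case by simp
next
  case (Forall x \<phi>)
  then show ?case using Forall.IH[of "insert x B" "QForall x # qs"] by (cases "x = y") simp_all
next
  case (Exists x \<phi>)
  then show ?case using Exists.IH[of "insert x B" "QExists x # qs"] by (cases "x = y") simp_all
qed fastforce+

lemma sat_not_free:
  "free_depths y \<phi> = {} \<Longrightarrow> sat M \<phi> s (\<theta>(Var y := m)) = sat M \<phi> s \<theta>"
  "free_depths_path y \<chi> = {} \<Longrightarrow> sat_path M \<chi> \<pi> (\<theta>(Var y := m)) = sat_path M \<chi> \<pi> \<theta>"
proof (induction \<phi> and \<chi> arbitrary: s \<theta> and \<pi> \<theta>)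
  case (Forall x \<phi>)
  then show ?case by (cases "x = y") (simp_all add: fun_upd_twist[of "Var y" "Var x"] del: fun_upd_apply)
next
  case (Exists x \<phi>)
  then show ?case by (cases "x = y") (simp_all add: fun_upd_twist[of "Var y" "Var x"] del: fun_upd_apply)
next
  case (Coal t1 t2 \<chi>)
  then show ?case by (simp split: if_splits)
qed simp_all

section \<open>Extensions of formulas\<close>

text \<open>Turns equivalences of formulas into equations between sets of states, with quantifiers
  as unions and intersections over numbers of agents.\<close>

definition extension :: "('ag, 's, 'p) hdmas \<Rightarrow> 'p state_formula \<Rightarrow> assignment \<Rightarrow> 's set" where
  "extension M \<phi> \<theta> = {s \<in> states M. sat M \<phi> s \<theta>}"

lemma extension_not_free:
  "free_depths y \<phi> = {} \<Longrightarrow> extension M \<phi> (\<theta>(Var y := m)) = extension M \<phi> \<theta>"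
  by (simp add: extension_def sat_not_free)

lemma extension_connectives:
  "extension M (And \<phi> \<psi>) \<theta> = extension M \<phi> \<theta> \<inter> extension M \<psi> \<theta>"
  "extension M (Or \<phi> \<psi>) \<theta> = extension M \<phi> \<theta> \<union> extension M \<psi> \<theta>"
  "extension M (Forall y \<phi>) \<theta> = (\<Inter>m. extension M \<phi> (\<theta>(Var y := m)))"
  "extension M (Exists y \<phi>) \<theta> = (\<Union>m. extension M \<phi> (\<theta>(Var y := m)))"
  by (auto simp: extension_def)

lemma extension_Coal:
  "extension M (Coal t1 t2 \<chi>) \<theta> = enforce M (\<theta> t1) (\<theta> t2) (\<lambda>\<pi>. sat_path M \<chi> \<pi> \<theta>)"
  by (simp add: extension_def enforce_def)

lemma enforce_cong:
  assumes "\<And>\<pi>. range \<pi> \<subseteq> states M \<Longrightarrow> P \<pi> = Q \<pi>"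
  shows "enforce M C N P = enforce M C N Q"
proof -
  have "P \<pi> = Q \<pi>" if "\<pi> \<in> outcome_plays M s \<sigma> N" for \<pi> s \<sigma>
    using that by (intro assms) (auto simp: outcome_plays_def)
  then show ?thesis unfolding enforce_def by blast
qed

lemma extension_Always:
  "extension M (Coal t1 t2 (Always \<phi>)) \<theta> =
    enforce M (\<theta> t1) (\<theta> t2) (always (extension M \<phi> \<theta>))"
  unfolding extension_Coal by (rule enforce_cong) (auto simp: always_def extension_def)

lemma extension_Until:
  "extension M (Coal t1 t2 (Until \<psi> \<phi>)) \<theta> =
    enforce M (\<theta> t1) (\<theta> t2) (until (extension M \<psi> \<theta>) (extension M \<phi> \<theta>))"
  unfolding extension_Coal by (rule enforce_cong) (auto simp: until_def extension_def)

lemma equivalentI: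
  fixes T :: "('ag, 's, 'p) hdmas itself"
  assumes "\<And>(M :: ('ag, 's, 'p) hdmas) \<theta>. is_hdmas M \<Longrightarrow> extension M \<phi> \<theta> = extension M \<psi> \<theta>"
  shows "equivalent T \<phi> \<psi>"
  using assms unfolding equivalent_def extension_def by blast

lemma equivalent_finI:
  fixes T :: "('ag, 's, 'p) hdmas itself"
  assumes "\<And>(M :: ('ag, 's, 'p) hdmas) \<theta>. is_hdmas M \<Longrightarrow> finite (states M) \<Longrightarrow>
    extension M \<phi> \<theta> = extension M \<psi> \<theta>"
  shows "equivalent_fin T \<phi> \<psi>"
  using assms unfolding equivalent_fin_def extension_def by blast

context hdmas_model
begin

lemma extension_Next:
  "extension M (Coal t1 t2 (Next \<phi>)) \<theta> = cpre M (\<theta> t1) (\<theta> t2) (extension M \<phi> \<theta>)"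
  unfolding extension_Coal enforce_next[symmetric]
  by (rule enforce_cong) (auto simp: extension_def)

lemmas extension_simps = extension_connectives extension_Always extension_Until extension_Next

lemma fixpoint_family_always:
  assumes "finite (states M)"
  shows "fixpoint_family (states M) {} F (cpre M) (\<lambda>C N. enforce M C N (always F))"
  by unfold_locales
    (use assms enforce_mono cpre_mono_agents enforce_always_unfold[of _ _ F] in
      \<open>simp_all add: enforce_def\<close>)

text \<open>The intersection \<open>states M \<inter> F\<close> is the base because
  \<open>enforce\<close> yields only states of the model.\<close>

lemma fixpoint_family_until:
  assumes "finite (states M)"
  shows "fixpoint_family (states M) (states M \<inter> F) P (cpre M) (\<lambda>C N. enforce M C N (until P F))"
  by unfold_locales
    (use assms enforce_mono cpre_mono_agents enforce_until_unfold[of _ _ P F] in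
      \<open>simp_all add: enforce_def\<close>)

end

text \<open>The quantifiers in front are separated from the operands of \<open>\<chi>\<close> by the
  temporal operator, so the normal form keeps their variables out of \<open>\<chi>\<close>. The
  conditions on \<open>t1\<close> and \<open>t2\<close> ensure that the unquantified term keeps its
  value when the quantified variable is updated.\<close>

lemma in_L0_not_free:
  "in_L0 (Exists Y1 (Coal t1 t2 \<chi>)) \<Longrightarrow> free_depths_path Y1 \<chi> = {} \<and> t2 \<noteq> Var Y1"
  "in_L0 (Forall Y2 (Coal t1 t2 \<chi>)) \<Longrightarrow> free_depths_path Y2 \<chi> = {} \<and> t1 \<noteq> Var Y2"
  "in_L0 (Forall Y2 (Exists Y1 (Coal t1 t2 \<chi>))) \<Longrightarrow>
    free_depths_path Y1 \<chi> = {} \<and> free_depths_path Y2 \<chi> = {}"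
  "in_L0 (Exists Y1 (Forall Y2 (Coal t1 t2 \<chi>))) \<Longrightarrow>
    free_depths_path Y1 \<chi> = {} \<and> free_depths_path Y2 \<chi> = {}"
  unfolding in_L0_def by (auto simp: Let_def dest: normal_form_not_free(2))

section \<open>Unfolding equivalences for formulas in normal form\<close>

theorem theorem3:
  fixes T :: "('ag, 's, 'p) hdmas itself"
    and t t' t'' :: tm
    and \<phi> \<psi> :: "'p state_formula"
  shows
    "(in_L0 (Coal t' t'' (Always \<phi>)) \<longrightarrow>
       equivalent T
         (Coal t' t'' (Always \<phi>))
         (And \<phi> (Coal t' t'' (Next (Coal t' t'' (Always \<phi>)))))) \<and>
     (in_L0 (Coal t' t'' (Until \<psi> \<phi>)) \<longrightarrow>
       equivalent T
         (Coal t' t'' (Until \<psi> \<phi>))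
         (Or \<phi> (And \<psi> (Coal t' t'' (Next (Coal t' t'' (Until \<psi> \<phi>))))))) \<and>
     (in_L0 (Exists Y1 (Coal (Var Y1) t (Always \<phi>))) \<longrightarrow>
       equivalent_fin T
         (Exists Y1 (Coal (Var Y1) t (Always \<phi>)))
         (And \<phi> (Exists Y1 (Coal (Var Y1) t (Next (Exists Y1 (Coal (Var Y1) t (Always \<phi>)))))))) \<and>
     (in_L0 (Forall Y2 (Coal t (Var Y2) (Always \<phi>))) \<longrightarrow>
       equivalent_fin T
         (Forall Y2 (Coal t (Var Y2) (Always \<phi>)))
         (And \<phi> (Forall Y2 (Coal t (Var Y2) (Next (Forall Y2 (Coal t (Var Y2) (Always \<phi>)))))))) \<and>
     (in_L0 (Exists Y1 (Coal (Var Y1) t (Until \<psi> \<phi>))) \<longrightarrow>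
       equivalent_fin T
         (Exists Y1 (Coal (Var Y1) t (Until \<psi> \<phi>)))
         (Or \<phi> (And \<psi> (Exists Y1 (Coal (Var Y1) t (Next (Exists Y1 (Coal (Var Y1) t (Until \<psi> \<phi>))))))))) \<and>
     (in_L0 (Forall Y2 (Coal t (Var Y2) (Until \<psi> \<phi>))) \<longrightarrow>
       equivalent_fin T
         (Forall Y2 (Coal t (Var Y2) (Until \<psi> \<phi>)))
         (Or \<phi> (And \<psi> (Forall Y2 (Coal t (Var Y2) (Next (Forall Y2 (Coal t (Var Y2) (Until \<psi> \<phi>))))))))) \<and>
     (in_L0 (Forall Y2 (Exists Y1 (Coal (Var Y1) (Var Y2) (Always \<phi>)))) \<longrightarrow>
       equivalent_fin T
         (Forall Y2 (Exists Y1 (Coal (Var Y1) (Var Y2) (Always \<phi>))))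
         (And \<phi> (Forall Y2 (Exists Y1 (Coal (Var Y1) (Var Y2) (Next (Forall Y2 (Exists Y1 (Coal (Var Y1) (Var Y2) (Always \<phi>)))))))))) \<and>
     (in_L0 (Exists Y1 (Forall Y2 (Coal (Var Y1) (Var Y2) (Always \<phi>)))) \<longrightarrow>
       equivalent_fin T
         (Exists Y1 (Forall Y2 (Coal (Var Y1) (Var Y2) (Always \<phi>))))
         (And \<phi> (Exists Y1 (Forall Y2 (Coal (Var Y1) (Var Y2) (Next (Exists Y1 (Forall Y2 (Coal (Var Y1) (Var Y2) (Always \<phi>)))))))))) \<and>
     (in_L0 (Forall Y2 (Exists Y1 (Coal (Var Y1) (Var Y2) (Until \<psi> \<phi>)))) \<longrightarrow>
       equivalent_fin T
         (Forall Y2 (Exists Y1 (Coal (Var Y1) (Var Y2) (Until \<psi> \<phi>))))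
         (Or \<phi> (And \<psi> (Forall Y2 (Exists Y1 (Coal (Var Y1) (Var Y2) (Next (Forall Y2 (Exists Y1 (Coal (Var Y1) (Var Y2) (Until \<psi> \<phi>))))))))))) \<and>
     (in_L0 (Exists Y1 (Forall Y2 (Coal (Var Y1) (Var Y2) (Until \<psi> \<phi>)))) \<longrightarrow>
       equivalent_fin T
         (Exists Y1 (Forall Y2 (Coal (Var Y1) (Var Y2) (Until \<psi> \<phi>))))
         (Or \<phi> (And \<psi> (Exists Y1 (Forall Y2 (Coal (Var Y1) (Var Y2) (Next (Exists Y1 (Forall Y2 (Coal (Var Y1) (Var Y2) (Until \<psi> \<phi>)))))))))))"
proof (intro conjI impI, goal_cases)
  case 1
  show ?case
  proof (rule equivalentI)
    fix M :: "('ag, 's, 'p) hdmas" and \<theta> assume "is_hdmas M"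
    then interpret hdmas_model M by unfold_locales
    show "extension M (Coal t' t'' (Always \<phi>)) \<theta> =
        extension M (And \<phi> (Coal t' t'' (Next (Coal t' t'' (Always \<phi>))))) \<theta>"
      unfolding extension_simps by (rule enforce_always_unfold)
  qed
next
  case 2
  show ?case
  proof (rule equivalentI)
    fix M :: "('ag, 's, 'p) hdmas" and \<theta> assume "is_hdmas M"
    then interpret hdmas_model M by unfold_locales
    have "states M \<inter> extension M \<phi> \<theta> = extension M \<phi> \<theta>" by (auto simp: extension_def)
    then show "extension M (Coal t' t'' (Until \<psi> \<phi>)) \<theta> =
        extension M (Or \<phi> (And \<psi> (Coal t' t'' (Next (Coal t' t'' (Until \<psi> \<phi>)))))) \<theta>"
      unfolding extension_simps by (metis enforce_until_unfold)
  qed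
next
  case 3
  note nf = in_L0_not_free(1)[OF 3]
  show ?case
  proof (rule equivalent_finI)
    fix M :: "('ag, 's, 'p) hdmas" and \<theta> assume M: "is_hdmas M" "finite (states M)"
    then interpret hdmas_model M by unfold_locales
    interpret fixpoint_family "states M" "{}" "extension M \<phi> \<theta>" "cpre M"
      "\<lambda>C N. enforce M C N (always (extension M \<phi> \<theta>))"
      by (rule fixpoint_family_always[OF M(2)])
    show "extension M (Exists Y1 (Coal (Var Y1) t (Always \<phi>))) \<theta> = extension M
        (And \<phi> (Exists Y1 (Coal (Var Y1) t (Next (Exists Y1 (Coal (Var Y1) t (Always \<phi>))))))) \<theta>"
      \<comment> \<open>By independence, \<open>\<phi>\<close> and \<open>t\<close> keep their
        values when \<open>Y1\<close> is updated, and the inner \<open>Exists Y1\<close> overwrites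
        the outer update. What remains is the set equation with \<open>\<theta> t\<close>
        opponents.\<close>
      using nf unfold_Union[of "\<theta> t"] by (simp add: extension_simps extension_not_free)
  qed
next
  case 4
  note nf = in_L0_not_free(2)[OF 4]
  show ?case
  proof (rule equivalent_finI)
    fix M :: "('ag, 's, 'p) hdmas" and \<theta> assume M: "is_hdmas M" "finite (states M)"
    then interpret hdmas_model M by unfold_locales
    interpret fixpoint_family "states M" "{}" "extension M \<phi> \<theta>" "cpre M"
      "\<lambda>C N. enforce M C N (always (extension M \<phi> \<theta>))"
      by (rule fixpoint_family_always[OF M(2)])
    show "extension M (Forall Y2 (Coal t (Var Y2) (Always \<phi>))) \<theta> = extension M
        (And \<phi> (Forall Y2 (Coal t (Var Y2) (Next (Forall Y2 (Coal t (Var Y2) (Always \<phi>))))))) \<theta>"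
      using nf unfold_Inter[of "\<theta> t"] by (simp add: extension_simps extension_not_free)
  qed
next
  case 5
  note nf = in_L0_not_free(1)[OF 5]
  show ?case
  proof (rule equivalent_finI)
    fix M :: "('ag, 's, 'p) hdmas" and \<theta> assume M: "is_hdmas M" "finite (states M)"
    then interpret hdmas_model M by unfold_locales
    interpret fixpoint_family "states M" "states M \<inter> extension M \<phi> \<theta>" "extension M \<psi> \<theta>" "cpre M"
      "\<lambda>C N. enforce M C N (until (extension M \<psi> \<theta>) (extension M \<phi> \<theta>))"
      by (rule fixpoint_family_until[OF M(2)])
    \<comment> \<open>Matches the base set of the fixpoint family with the plain extension in the
      formula.\<close>
    have "states M \<inter> extension M \<phi> \<theta> = extension M \<phi> \<theta>" by (auto simp: extension_def)
    then show "extension M (Exists Y1 (Coal (Var Y1) t (Until \<psi> \<phi>))) \<theta> = extension M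
        (Or \<phi> (And \<psi> (Exists Y1 (Coal (Var Y1) t
          (Next (Exists Y1 (Coal (Var Y1) t (Until \<psi> \<phi>)))))))) \<theta>"
      using nf unfold_Union[of "\<theta> t"] by (simp add: extension_simps extension_not_free)
  qed
next
  case 6
  note nf = in_L0_not_free(2)[OF 6]
  show ?case
  proof (rule equivalent_finI)
    fix M :: "('ag, 's, 'p) hdmas" and \<theta> assume M: "is_hdmas M" "finite (states M)"
    then interpret hdmas_model M by unfold_locales
    interpret fixpoint_family "states M" "states M \<inter> extension M \<phi> \<theta>" "extension M \<psi> \<theta>" "cpre M"
      "\<lambda>C N. enforce M C N (until (extension M \<psi> \<theta>) (extension M \<phi> \<theta>))"
      by (rule fixpoint_family_until[OF M(2)])
    have "states M \<inter> extension M \<phi> \<theta> = extension M \<phi> \<theta>" by (auto simp: extension_def)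
    then show "extension M (Forall Y2 (Coal t (Var Y2) (Until \<psi> \<phi>))) \<theta> = extension M
        (Or \<phi> (And \<psi> (Forall Y2 (Coal t (Var Y2)
          (Next (Forall Y2 (Coal t (Var Y2) (Until \<psi> \<phi>)))))))) \<theta>"
      using nf unfold_Inter[of "\<theta> t"] by (simp add: extension_simps extension_not_free)
  qed
next
  case 7
  note nf = in_L0_not_free(3)[OF 7]
  show ?case
  proof (rule equivalent_finI)
    fix M :: "('ag, 's, 'p) hdmas" and \<theta> assume M: "is_hdmas M" "finite (states M)"
    then interpret hdmas_model M by unfold_locales
    interpret fixpoint_family "states M" "{}" "extension M \<phi> \<theta>" "cpre M"
      "\<lambda>C N. enforce M C N (always (extension M \<phi> \<theta>))"
      by (rule fixpoint_family_always[OF M(2)])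
    show "extension M (Forall Y2 (Exists Y1 (Coal (Var Y1) (Var Y2) (Always \<phi>)))) \<theta> = extension M
        (And \<phi> (Forall Y2 (Exists Y1 (Coal (Var Y1) (Var Y2)
          (Next (Forall Y2 (Exists Y1 (Coal (Var Y1) (Var Y2) (Always \<phi>))))))))) \<theta>"
      using nf unfold_Inter_Union by (simp add: extension_simps extension_not_free)
  qed
next
  case 8
  note nf = in_L0_not_free(4)[OF 8]
  show ?case
  proof (rule equivalent_finI)
    fix M :: "('ag, 's, 'p) hdmas" and \<theta> assume M: "is_hdmas M" "finite (states M)"
    then interpret hdmas_model M by unfold_locales
    interpret fixpoint_family "states M" "{}" "extension M \<phi> \<theta>" "cpre M"
      "\<lambda>C N. enforce M C N (always (extension M \<phi> \<theta>))"
      by (rule fixpoint_family_always[OF M(2)])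
    show "extension M (Exists Y1 (Forall Y2 (Coal (Var Y1) (Var Y2) (Always \<phi>)))) \<theta> = extension M
        (And \<phi> (Exists Y1 (Forall Y2 (Coal (Var Y1) (Var Y2)
          (Next (Exists Y1 (Forall Y2 (Coal (Var Y1) (Var Y2) (Always \<phi>))))))))) \<theta>"
      using nf unfold_Union_Inter by (simp add: extension_simps extension_not_free)
  qed
next
  case 9
  note nf = in_L0_not_free(3)[OF 9]
  show ?case
  proof (rule equivalent_finI)
    fix M :: "('ag, 's, 'p) hdmas" and \<theta> assume M: "is_hdmas M" "finite (states M)"
    then interpret hdmas_model M by unfold_locales
    interpret fixpoint_family "states M" "states M \<inter> extension M \<phi> \<theta>" "extension M \<psi> \<theta>" "cpre M"
      "\<lambda>C N. enforce M C N (until (extension M \<psi> \<theta>) (extension M \<phi> \<theta>))"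
      by (rule fixpoint_family_until[OF M(2)])
    have "states M \<inter> extension M \<phi> \<theta> = extension M \<phi> \<theta>" by (auto simp: extension_def)
    then show "extension M (Forall Y2 (Exists Y1 (Coal (Var Y1) (Var Y2) (Until \<psi> \<phi>)))) \<theta> = extension M
        (Or \<phi> (And \<psi> (Forall Y2 (Exists Y1 (Coal (Var Y1) (Var Y2)
          (Next (Forall Y2 (Exists Y1 (Coal (Var Y1) (Var Y2) (Until \<psi> \<phi>)))))))))) \<theta>"
      using nf unfold_Inter_Union by (simp add: extension_simps extension_not_free)
  qed
next
  case 10
  note nf = in_L0_not_free(4)[OF 10]
  show ?case
  proof (rule equivalent_finI)
    fix M :: "('ag, 's, 'p) hdmas" and \<theta> assume M: "is_hdmas M" "finite (states M)"
    then interpret hdmas_model M by unfold_locales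
    interpret fixpoint_family "states M" "states M \<inter> extension M \<phi> \<theta>" "extension M \<psi> \<theta>" "cpre M"
      "\<lambda>C N. enforce M C N (until (extension M \<psi> \<theta>) (extension M \<phi> \<theta>))"
      by (rule fixpoint_family_until[OF M(2)])
    have "states M \<inter> extension M \<phi> \<theta> = extension M \<phi> \<theta>" by (auto simp: extension_def)
    then show "extension M (Exists Y1 (Forall Y2 (Coal (Var Y1) (Var Y2) (Until \<psi> \<phi>)))) \<theta> = extension M
        (Or \<phi> (And \<psi> (Exists Y1 (Forall Y2 (Coal (Var Y1) (Var Y2)
          (Next (Exists Y1 (Forall Y2 (Coal (Var Y1) (Var Y2) (Until \<psi> \<phi>)))))))))) \<theta>"
      using nf unfold_Union_Inter by (simp add: extension_simps extension_not_free)
  qed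
qed

end
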